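(* Let $PW$ denote the paw graph. Then $\mathrm{Rs}(PW)=31$.
   Context: All graphs are finite and simple. The paw $PW$ is the graph with four vertices and four edges obtained from $K_3$ by adding a new vertex adjacent to exactly one vertex of the triangle. A (not necessarily induced) subgraph $H$ of a host graph $F$ is singular if the degrees $d_F(v)$, $v\in V(H)$, taken in $F$, are all equal or pairwise distinct. In an edge 2-coloring of $K_m$, the host graph of a color is the spanning graph on all $m$ vertices formed by the edges of that color. The singular Ramsey number $\mathrm{Rs}(G)$ is the smallest integer $N$ such that for every $m\ge N$ and every 2-coloring of the edges of $K_m$, at least one of the two color graphs contains a singular subgraph isomorphic to $G$. *)

theory Defs
  imports "HOL-Library.Ramsey"
begin

text \<open>
  A graph is a pair of a vertex set and a set of edges, where an edge is a two-element set
  of vertices.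
\<close>

type_synonym 'a graph = "'a set \<times> 'a set set"

abbreviation verts :: "'a graph \<Rightarrow> 'a set" where
  "verts G \<equiv> fst G"

abbreviation edges :: "'a graph \<Rightarrow> 'a set set" where
  "edges G \<equiv> snd G"

definition simple_graph :: "'a graph \<Rightarrow> bool" where
  "simple_graph G \<longleftrightarrow> finite (verts G) \<and> edges G \<subseteq> [verts G]\<^bsup>2\<^esup>"

definition degree :: "'a graph \<Rightarrow> 'a \<Rightarrow> nat" where
  "degree G v = card {e \<in> edges G. v \<in> e}"

definition subgraph :: "'a graph \<Rightarrow> 'a graph \<Rightarrow> bool" where
  "subgraph H F \<longleftrightarrow> simple_graph H \<and> verts H \<subseteq> verts F \<and> edges H \<subseteq> edges F"

definition graph_iso :: "'a graph \<Rightarrow> 'b graph \<Rightarrow> bool" where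
  "graph_iso G H \<longleftrightarrow>
     (\<exists>\<phi>. bij_betw \<phi> (verts G) (verts H) \<and>
       (\<forall>u \<in> verts G. \<forall>v \<in> verts G. {u, v} \<in> edges G \<longleftrightarrow> {\<phi> u, \<phi> v} \<in> edges H))"

definition singular_subgraph :: "'a graph \<Rightarrow> 'a graph \<Rightarrow> bool" where
  "singular_subgraph H F \<longleftrightarrow> subgraph H F \<and>
     ((\<forall>u \<in> verts H. \<forall>v \<in> verts H. degree F u = degree F v) \<or>
      (\<forall>u \<in> verts H. \<forall>v \<in> verts H. u \<noteq> v \<longrightarrow> degree F u \<noteq> degree F v))"

text \<open>
  The complete graph on \<open>m\<close> vertices has vertex set \<open>{..<m}\<close>. The two colors are the two Boolean
  values; only the values of a coloring on two-element subsets of \<open>{..<m}\<close> matter.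
\<close>

definition color_graph :: "nat \<Rightarrow> (nat set \<Rightarrow> bool) \<Rightarrow> bool \<Rightarrow> nat graph" where
  "color_graph m c i = ({..<m}, {e \<in> [{..<m}]\<^bsup>2\<^esup>. c e = i})"

definition singular_Ramsey_bound :: "'a graph \<Rightarrow> nat \<Rightarrow> bool" where
  "singular_Ramsey_bound G N \<longleftrightarrow>
     (\<forall>m \<ge> N. \<forall>c :: nat set \<Rightarrow> bool. \<exists>i. \<exists>H.
        singular_subgraph H (color_graph m c i) \<and> graph_iso G H)"

text \<open>
  This value is only meaningful for graphs \<open>G\<close> that satisfy \<open>singular_Ramsey_bound G N\<close>
  for some \<open>N\<close>; otherwise it is an unspecified number.
\<close>

definition Rs :: "'a graph \<Rightarrow> nat" where
  "Rs G = (LEAST N. singular_Ramsey_bound G N)"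

definition PW :: "nat graph" where
  "PW = ({0, 1, 2, 3}, {{0, 1}, {0, 2}, {1, 2}, {2, 3}})"

end

theory Submission
  imports Defs
begin

text \<open>
  Two vertices have the same degree in one color iff they have the same degree in the other, so
  the coloring partitions the vertices into degree classes, and a paw is singular iff it lies
  inside one class or meets four different classes. Hence a coloring without a singular
  monochromatic paw is one in which every class, and every transversal of the classes, contains
  no monochromatic paw at all.

  Upper bound. If a paw-free coloring has a triangle in color \<open>i\<close>, then all edges leaving the
  triangle have the other color, and therefore all edges outside it have color \<open>i\<close> again
  (\<open>triangle_forces_coloring\<close>). As any six vertices contain a monochromatic triangle, a paw-free
  set has at most six vertices, and if it has six, it consists of two triangles in color \<open>i\<close>
  with only the other color in between (\<open>paw_free_six_vertices\<close>). So there are at most six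
  classes, each of size at most six, and on at least 31 vertices there are exactly six classes.
  Exchanging one vertex of a transversal leaves one of its two triangles intact, and that
  triangle dictates all colors at the new vertex; thus the color between two classes is constant
  (\<open>color_between_classes\<close>). Consequently the vertices split into two sides \<open>A\<close> and \<open>B\<close> of three
  classes each, with color \<open>i\<close> between classes of the same side and the other color between the
  sides.

  Let \<open>b\<close> be the degree in the other color inside a class. A vertex of \<open>A\<close> has degree
  \<open>card A - 1 - b\<close> in color \<open>i\<close>, so the three classes of a side have distinct \<open>b\<close>. A paw-free
  class has \<open>b \<le> 3\<close>, and at most 3, 4, 6, 6 vertices for \<open>b = 0, 1, 2, 3\<close>. Hence each side uses
  all of \<open>{0..3}\<close> but one value \<open>x\<close>, and has at most 19 minus the bound for \<open>x\<close> vertices. With 31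
  vertices, both missing values are 0 or 1 and the sizes of the sides differ by at most one; as
  \<open>b = 2\<close> and \<open>b = 3\<close> occur on both sides, a degree of \<open>A\<close> coincides with a degree of \<open>B\<close>,
  which is impossible for different classes (\<open>no_coloring_on_31_vertices\<close>).

  Lower bound. On 30 vertices there are five classes of size six. Two classes lie on one side, two
  on the other, and the fifth is divided between the sides as 1 + 5. Edges between classes are
  red iff their ends are on the same side; each class is colored by two triangles of one color
  with the other color in between. The triangle colors are chosen so that the red degrees of the
  classes are 10, 9, 14, 13, 15. Inside a class and on a transversal alike, the color of an edge
  only depends on whether its ends are in the same part of a bipartition, and no part is large
  enough to contain a paw.
\<close>

section \<open>Two-colorings without monochromatic paws\<close>

definition paw :: "('a set \<Rightarrow> bool) \<Rightarrow> bool \<Rightarrow> 'a \<Rightarrow> 'a \<Rightarrow> 'a \<Rightarrow> 'a \<Rightarrow> bool" where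
  "paw c i x y z w \<longleftrightarrow> distinct [x, y, z, w] \<and>
     c {x, y} = i \<and> c {x, z} = i \<and> c {y, z} = i \<and> c {z, w} = i"

definition paw_free :: "('a set \<Rightarrow> bool) \<Rightarrow> 'a set \<Rightarrow> bool" where
  "paw_free c W \<longleftrightarrow> (\<forall>i. \<forall>x\<in>W. \<forall>y\<in>W. \<forall>z\<in>W. \<forall>w\<in>W. \<not> paw c i x y z w)"

definition mono_on_pairs :: "('a set \<Rightarrow> bool) \<Rightarrow> bool \<Rightarrow> 'a set \<Rightarrow> bool" where
  "mono_on_pairs c i U \<longleftrightarrow> (\<forall>x\<in>U. \<forall>y\<in>U. x \<noteq> y \<longrightarrow> c {x, y} = i)"

lemma paw_freeD:
  assumes "paw_free c W" "x \<in> W" "y \<in> W" "z \<in> W" "w \<in> W" "distinct [x, y, z, w]"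
    "c {x, y} = i" "c {x, z} = i" "c {y, z} = i"
  shows "c {z, w} \<noteq> i"
  using assms unfolding paw_free_def paw_def by blast

lemma mono_on_pairsD: "mono_on_pairs c i U \<Longrightarrow> x \<in> U \<Longrightarrow> y \<in> U \<Longrightarrow> x \<noteq> y \<Longrightarrow> c {x, y} = i"
  by (simp add: mono_on_pairs_def)

lemma paw_free_mono_card_le_3:
  assumes "paw_free c W" "U \<subseteq> W" "finite U" "mono_on_pairs c i U"
  shows "card U \<le> 3"
proof (rule ccontr)
  assume "\<not> card U \<le> 3"
  then have "4 \<le> card U" by simp
  then obtain T where "T \<subseteq> U" "card T = 4"
    by (meson obtain_subset_with_card_n)
  then obtain x y z w where "T = {x, y, z, w}" "distinct [x, y, z, w]"
    by (auto simp: card_Suc_eq numeral_eq_Suc)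
  with \<open>T \<subseteq> U\<close> assms show False
    using paw_freeD[of c W x y z w i] mono_on_pairsD[OF assms(4)] by auto
qed

text \<open>
  An edge of color \<open>i\<close> leaving the triangle \<open>U\<close> would be the pendant edge of a paw. Two
  outside vertices joined in the other color would form, with a vertex of \<open>U\<close>, a triangle of
  that color, and another vertex of \<open>U\<close> would be pendant to it.
\<close>

lemma triangle_forces_coloring:
  assumes pf: "paw_free c W" and U: "U \<subseteq> W" "card U = 3" "mono_on_pairs c i U"
  shows triangle_forces_cross: "x \<in> W - U \<Longrightarrow> u \<in> U \<Longrightarrow> c {x, u} \<noteq> i"
    and triangle_forces_rest: "mono_on_pairs c i (W - U)"
proof -
  have cross: "c {x, u} \<noteq> i" if x: "x \<in> W - U" and u: "u \<in> U" for x u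
  proof -
    have "card (U - {u}) = 2" using U u by simp
    then obtain v w where "U - {u} = {v, w}" "v \<noteq> w"
      by (meson card_2_iff)
    then have *: "v \<in> U" "w \<in> U" "u \<noteq> v" "u \<noteq> w" "v \<noteq> w" by auto
    have "c {u, x} \<noteq> i"
      by (rule paw_freeD[OF pf, of v w]) (use x u * U mono_on_pairsD[OF U(3)] in auto)
    then show ?thesis by (simp add: insert_commute)
  qed
  show "c {x, u} \<noteq> i" if "x \<in> W - U" "u \<in> U" using cross that .
  show "mono_on_pairs c i (W - U)" unfolding mono_on_pairs_def
  proof (intro ballI impI, rule ccontr)
    fix x y assume xy: "x \<in> W - U" "y \<in> W - U" "x \<noteq> y" "c {x, y} \<noteq> i"
    obtain u v where uv: "u \<in> U" "v \<in> U" "u \<noteq> v"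
      using U(2) unfolding card_3_iff by blast
    \<comment> \<open>A pair \<open>x, y\<close> of the opposite color would form a triangle with \<open>u\<close>, with \<open>v\<close> pendant at \<open>y\<close>.\<close>
    have "c {y, v} \<noteq> (\<not> i)"
      by (rule paw_freeD[OF pf, of u x])
        (use xy uv U cross[of x u] cross[of y u] in \<open>auto simp: insert_commute\<close>)
    with cross[of y v] xy uv show False by auto
  qed
qed

text \<open>
  The classical argument for \<open>R(3, 3) \<le> 6\<close>: some vertex has three neighbors in one color.
\<close>

lemma six_vertices_mono_triangle:
  assumes "finite W" "6 \<le> card W"
  obtains i U where "U \<subseteq> W" "card U = 3" "mono_on_pairs c i U"
proof -
  obtain v where v: "v \<in> W" using assms by (metis card.empty ex_in_conv not_numeral_le_zero)
  define N where "N i = {w \<in> W - {v}. c {v, w} = i}" for i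
  have fin: "finite (N i)" for i using assms by (simp add: N_def)
  have "card (N True \<union> N False) = card (N True) + card (N False)"
    by (rule card_Un_disjoint) (auto simp: fin, auto simp: N_def)
  moreover have "N True \<union> N False = W - {v}" by (auto simp: N_def)
  ultimately have "card (N True) + card (N False) \<ge> 5"
    using assms v by (simp add: card_Diff_singleton)
  then have "3 \<le> card (N True) \<or> 3 \<le> card (N False)" by linarith
  then obtain i where "3 \<le> card (N i)" by blast
  then obtain T where T: "T \<subseteq> N i" "card T = 3"
    by (meson obtain_subset_with_card_n)
  show thesis
  proof (cases "mono_on_pairs c (\<not> i) T")
    case True
    with T that show thesis by (auto simp: N_def)
  next
    case False
    then obtain x y where xy: "x \<in> T" "y \<in> T" "x \<noteq> y" "c {x, y} = i"
      by (auto simp: mono_on_pairs_def)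
    then have *: "x \<in> N i" "y \<in> N i" using T by auto
    then have "mono_on_pairs c i {v, x, y}"
      using xy by (auto simp: mono_on_pairs_def N_def insert_commute)
    moreover have "card {v, x, y} = 3" "{v, x, y} \<subseteq> W" using * xy v by (auto simp: N_def)
    ultimately show thesis using that by blast
  qed
qed

lemma paw_free_six_vertices:
  assumes "finite W" "6 \<le> card W" "paw_free c W"
  obtains i U where "card W = 6" "U \<subseteq> W" "card U = 3" "card (W - U) = 3"
    "mono_on_pairs c i U" "mono_on_pairs c i (W - U)"
proof -
  obtain i U where U: "U \<subseteq> W" "card U = 3" "mono_on_pairs c i U"
    using six_vertices_mono_triangle assms by metis
  have rest: "mono_on_pairs c i (W - U)"
    using triangle_forces_rest[OF assms(3) U] .
  have "finite U" using U(1) assms(1) finite_subset by blast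
  have "card (W - U) \<le> 3"
    by (rule paw_free_mono_card_le_3[OF assms(3) _ _ rest]) (use assms in auto)
  moreover have "card (W - U) = card W - 3"
    using U \<open>finite U\<close> by (simp add: card_Diff_subset)
  ultimately have "card W = 6" "card (W - U) = 3" using assms(2) by auto
  with U rest that show thesis by blast
qed

lemma paw_free_card_le_6:
  assumes "finite W" "paw_free c W"
  shows "card W \<le> 6"
  using paw_free_six_vertices[OF assms(1) _ assms(2)] by (metis nat_le_linear order_refl)

text \<open>
  A class that is nearly complete in the other color is small: a vertex \<open>v\<close> of a five-element
  class has three neighbors in the other color, at most one pair of which has color \<open>i\<close>; two of
  them therefore form a triangle with \<open>v\<close> to which a further neighbor is pendant.
\<close>

lemma paw_free_max_degree_1_card_le_4:
  assumes "finite C" "paw_free c C"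
    and deg: "\<And>v. v \<in> C \<Longrightarrow> card {w \<in> C. w \<noteq> v \<and> c {v, w} = i} \<le> 1"
  shows "card C \<le> 4"
proof (rule ccontr)
  assume "\<not> card C \<le> 4"
  then have c5: "5 \<le> card C" by simp
  then obtain v where v: "v \<in> C" by (metis card.empty ex_in_conv not_numeral_le_zero)
  define M where "M = {w \<in> C. w \<noteq> v \<and> c {v, w} = i}"
  define N where "N = {w \<in> C. w \<noteq> v \<and> c {v, w} \<noteq> i}"
  have "C - {v} = M \<union> N" by (auto simp: M_def N_def)
  then have "card C - 1 \<le> card M + card N"
    using v assms(1) card_Un_le[of M N] by (metis card_Diff_singleton)
  moreover have "card M \<le> 1" using deg[OF v] by (simp add: M_def)
  ultimately have "3 \<le> card N" using c5 by simp
  then obtain T where T: "T \<subseteq> N" "card T = 3" by (meson obtain_subset_with_card_n)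
  then obtain x y z where xyz: "T = {x, y, z}" "x \<noteq> y" "x \<noteq> z" "y \<noteq> z"
    by (metis card_3_iff)
  have in_C: "x \<in> C" "y \<in> C" "z \<in> C" using T xyz by (auto simp: N_def)
  have "\<not> (c {x, y} = i \<and> c {x, z} = i)"
  proof
    assume "c {x, y} = i \<and> c {x, z} = i"
    then have "{y, z} \<subseteq> {w \<in> C. w \<noteq> x \<and> c {x, w} = i}" using xyz in_C by auto
    then have "card {y, z} \<le> card {w \<in> C. w \<noteq> x \<and> c {x, w} = i}"
      by (intro card_mono) (use assms(1) in auto)
    then have "card {y, z} \<le> 1" using deg[OF in_C(1)] by simp
    with xyz show False by simp
  qed
  \<comment> \<open>The triangle \<open>p, q, v\<close> has the color opposite to \<open>i\<close>, and so does the pendant edge to the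
    third neighbor \<open>r\<close>.\<close>
  then obtain p q where pq: "p \<in> T" "q \<in> T" "p \<noteq> q" "c {p, q} \<noteq> i"
    using xyz by auto
  have "card (T - {p, q}) = 1" using pq T by (simp add: card_Diff_subset)
  then obtain r where r: "r \<in> T" "r \<noteq> p" "r \<noteq> q"
    by (metis DiffD1 DiffD2 card_1_singletonE insertCI)
  have TN: "\<And>t. t \<in> T \<Longrightarrow> t \<in> C \<and> t \<noteq> v \<and> c {v, t} \<noteq> i" using T by (auto simp: N_def)
  have "c {v, r} \<noteq> (\<not> i)"
    by (rule paw_freeD[OF assms(2), of p q])
      (use TN[of p] TN[of q] TN[of r] pq r v in \<open>auto simp: insert_commute\<close>)
  with TN[OF r(1)] show False by simp
qed

section \<open>Sizes of regular classes\<close>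

definition color_degree :: "('a set \<Rightarrow> bool) \<Rightarrow> 'a set \<Rightarrow> bool \<Rightarrow> 'a \<Rightarrow> nat" where
  "color_degree c V i v = card {w \<in> V. w \<noteq> v \<and> c {v, w} = i}"

lemma color_degree_add:
  assumes "finite V" "v \<in> V"
  shows "color_degree c V i v + color_degree c V (\<not> i) v + 1 = card V"
proof -
  let ?N = "\<lambda>j. {w \<in> V. w \<noteq> v \<and> c {v, w} = j}"
  have "card V = card (insert v (?N i \<union> ?N (\<not> i)))"
    by (rule arg_cong[where f = card]) (use assms in auto)
  also have "\<dots> = card (?N i \<union> ?N (\<not> i)) + 1" using assms by simp
  also have "card (?N i \<union> ?N (\<not> i)) = card (?N i) + card (?N (\<not> i))"
    by (rule card_Un_disjoint) (use assms in auto)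
  finally show ?thesis by (simp add: color_degree_def)
qed

text \<open>
  An upper bound for the size of a paw-free set that is \<open>b\<close>-regular in one color.
\<close>

definition class_bound :: "nat \<Rightarrow> nat" where
  "class_bound b = (if b = 0 then 3 else if b = 1 then 4 else 6)"

lemma color_degree_0_card_le_3:
  assumes "finite C" "paw_free c C" "\<And>v. v \<in> C \<Longrightarrow> color_degree c C i v = 0"
  shows "card C \<le> 3"
proof (rule paw_free_mono_card_le_3[OF assms(2) order_refl assms(1)])
  have "{w \<in> C. w \<noteq> v \<and> c {v, w} = i} = {}" if "v \<in> C" for v
    using assms(1) assms(3)[OF that] by (simp add: color_degree_def)
  then show "mono_on_pairs c (\<not> i) C" by (fastforce simp: mono_on_pairs_def)
qed

text \<open>
  Small \<open>b\<close> means that the class is nearly complete in the color opposite to \<open>i\<close>. Conversely,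
  if \<open>b\<close> were at least 4, then, the size being at most 6, the opposite color would have degree at
  most 1, which leaves room for four vertices only.
\<close>

lemma regular_paw_free_bounds:
  assumes "finite C" "C \<noteq> {}" "paw_free c C"
    and deg: "\<And>v. v \<in> C \<Longrightarrow> color_degree c C i v = b"
  shows "b \<le> 3" and "card C \<le> class_bound b"
proof -
  have le6: "card C \<le> 6" using assms paw_free_card_le_6 by blast
  have le4: "card C \<le> 4" if "b \<le> 1"
    using paw_free_max_degree_1_card_le_4[OF assms(1,3), of i] deg that
    by (simp add: color_degree_def)
  have le3: "card C \<le> 3" if "b = 0"
    using color_degree_0_card_le_3[OF assms(1,3)] deg that by blast
  show "card C \<le> class_bound b"
    using le6 le4 le3 by (auto simp: class_bound_def)
  show "b \<le> 3"
  proof (rule ccontr)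
    assume b: "\<not> b \<le> 3"
    have compl: "color_degree c C (\<not> i) v = card C - 1 - b" if "v \<in> C" for v
      using color_degree_add[OF assms(1) that, of c i] deg[OF that] by simp
    have "card C \<ge> b + 1" using color_degree_add[OF assms(1), of _ c i] deg assms(2) by fastforce
    moreover have "card C \<le> 4"
      using paw_free_max_degree_1_card_le_4[OF assms(1,3), of "\<not> i"] compl le6 b
      by (auto simp: color_degree_def)
    ultimately show False using b by simp
  qed
qed

section \<open>The coloring between six classes\<close>

lemma transversal_through:
  assumes "u \<in> V" "v \<in> V" "f u \<noteq> f v"
  obtains W where "W \<subseteq> V" "inj_on f W" "f ` W = f ` V" "u \<in> W" "v \<in> W"
proof -
  define t where "t y = (if y = f u then u else if y = f v then v else inv_into V f y)" for y
  have t: "t y \<in> V \<and> f (t y) = y" if "y \<in> f ` V" for y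
    using that assms by (auto simp: t_def inv_into_into f_inv_into_f)
  show thesis
  proof
    show "t ` f ` V \<subseteq> V" using t by blast
    show "inj_on f (t ` f ` V)" using t by (auto intro!: inj_onI)
    show "f ` t ` f ` V = f ` V" using t by (metis (no_types, lifting) image_cong image_ident image_image)
    show "u \<in> t ` f ` V" using assms by (intro image_eqI[of _ _ "f u"]) (auto simp: t_def)
    show "v \<in> t ` f ` V" using assms by (intro image_eqI[of _ _ "f v"]) (auto simp: t_def)
  qed
qed

text \<open>
  Extend \<open>u, v\<close> to a transversal \<open>W\<close>. It consists of two triangles of one color, and the one
  avoiding \<open>u\<close> survives when \<open>u\<close> is exchanged for \<open>u'\<close>. By \<open>triangle_forces_coloring\<close> this
  triangle determines the colors at \<open>u\<close> and at \<open>u'\<close> in the same way.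
\<close>

lemma color_depends_on_one_class:
  assumes "finite V" "card (f ` V) = 6"
    and rainbow: "\<And>W. W \<subseteq> V \<Longrightarrow> inj_on f W \<Longrightarrow> paw_free c W"
    and u: "u \<in> V" "u' \<in> V" "f u' = f u" and v: "v \<in> V" "f v \<noteq> f u"
  shows "c {u', v} = c {u, v}"
proof (cases "u' = u")
  case False
  obtain W where W: "W \<subseteq> V" "inj_on f W" "f ` W = f ` V" "u \<in> W" "v \<in> W"
    using transversal_through[of u V v f] u v by metis
  have "finite W" using W(1) assms(1) finite_subset by blast
  have "card W = 6" using W assms(2) card_image by metis
  obtain i T where T: "T \<subseteq> W" "card T = 3" "card (W - T) = 3"
      "mono_on_pairs c i T" "mono_on_pairs c i (W - T)"
    using paw_free_six_vertices[OF \<open>finite W\<close> _ rainbow[OF W(1,2)]] \<open>card W = 6\<close>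
    by (metis order_refl)
  define U where "U = (if u \<in> T then W - T else T)"
  have U: "U \<subseteq> W" "card U = 3" "mono_on_pairs c i U" "u \<notin> U"
    using T by (auto simp: U_def)
  define W' where "W' = insert u' (W - {u})"
  have other: "f w \<noteq> f u" if "w \<in> W - {u}" for w
    using W(2,4) that by (auto dest: inj_onD)
  have "paw_free c W'"
  proof (rule rainbow)
    show "W' \<subseteq> V" using W(1) u by (auto simp: W'_def)
    have "f u' \<notin> f ` (W - {u})" using other u(3) by (metis imageE)
    then show "inj_on f W'" using inj_on_diff[OF W(2)] by (auto simp: W'_def)
  qed
  moreover have "U \<subseteq> W'" using U by (auto simp: W'_def)
  moreover have "u' \<notin> U" using U other[of u'] u(3) by auto
  moreover have "v \<in> W - {u}" using W v by auto
  moreover have "v \<noteq> u'" using v u by auto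
  ultimately have "c {x, v} = i \<longleftrightarrow> v \<notin> U" if "x = u \<or> x = u'" for x
  proof -
    \<comment> \<open>The same triangle \<open>U\<close> dictates the colors at \<open>u\<close> in \<open>W\<close> and at \<open>u'\<close> in \<open>W'\<close>.\<close>
    define X where "X = (if x = u then W else W')"
    have X: "paw_free c X" "U \<subseteq> X" "x \<in> X - U" "v \<in> X" "v \<noteq> x"
      using \<open>paw_free c W'\<close> \<open>U \<subseteq> W'\<close> \<open>u' \<notin> U\<close> \<open>v \<in> W - {u}\<close> \<open>v \<noteq> u'\<close> that U W
        rainbow[OF W(1,2)]
      by (auto simp: X_def W'_def)
    show ?thesis
      using triangle_forces_cross[OF X(1,2) U(2,3) X(3), of v]
        mono_on_pairsD[OF triangle_forces_rest[OF X(1,2) U(2,3)] X(3), of v] X(4,5)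
      by auto
  qed
  from this[of u] this[of u'] show ?thesis by auto
qed simp

lemma color_between_classes:
  assumes "finite V" "card (f ` V) = 6"
    and rainbow: "\<And>W. W \<subseteq> V \<Longrightarrow> inj_on f W \<Longrightarrow> paw_free c W"
    and "u \<in> V" "u' \<in> V" "v \<in> V" "v' \<in> V" "f u' = f u" "f v' = f v" "f v \<noteq> f u"
  shows "c {u', v'} = c {u, v}"
proof -
  have "c {u', v'} = c {u, v'}"
    by (rule color_depends_on_one_class[where f = f and V = V]) (use assms in auto)
  also have "\<dots> = c {v', u}" by (simp add: insert_commute)
  also have "\<dots> = c {v, u}"
    by (rule color_depends_on_one_class[where f = f and V = V]) (use assms in auto)
  finally show ?thesis by (simp add: insert_commute)
qed

text \<open>
  Every vertex of the side \<open>A\<close> other than \<open>v\<close> is joined to \<open>v\<close> in color \<open>i\<close>, except for the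
  neighbors of \<open>v\<close> in the other color within its own class.
\<close>

lemma side_degree:
  assumes "finite V" "A \<subseteq> V" "v \<in> A"
    and same: "{w \<in> V. f w = f v} \<subseteq> A"
    and cross: "\<And>w. w \<in> V \<Longrightarrow> f w \<noteq> f v \<Longrightarrow> c {v, w} = i \<longleftrightarrow> w \<in> A"
  shows "color_degree c V i v + color_degree c {w \<in> V. f w = f v} (\<not> i) v + 1 = card A"
proof -
  let ?D = "{w \<in> V. w \<noteq> v \<and> c {v, w} = i}"
  let ?B = "{w \<in> {w \<in> V. f w = f v}. w \<noteq> v \<and> c {v, w} = (\<not> i)}"
  have "A = insert v (?D \<union> ?B)" using assms by auto
  then have "card A = card (insert v (?D \<union> ?B))" by simp
  also have "\<dots> = card (?D \<union> ?B) + 1" using assms(1) by simp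
  also have "card (?D \<union> ?B) = card ?D + card ?B"
    by (rule card_Un_disjoint) (use assms(1) in auto)
  finally show ?thesis by (simp add: color_degree_def)
qed

text \<open>
  Here \<open>U\<close> consists of one vertex from each of the three classes of a side \<open>A\<close>. Their inner
  degrees \<open>b\<close> are three of the four values \<open>0..3\<close>; \<open>x\<close> is the one that is missing, and 19 is
  the sum \<open>3 + 4 + 6 + 6\<close> of all class bounds.
\<close>

lemma side_size_bound:
  assumes "finite V" "card U = 3" "inj_on f U" "U \<subseteq> V"
    and A: "A = {v \<in> V. f v \<in> f ` U}"
    and mono: "\<And>u. u \<in> U \<Longrightarrow> paw_free c {w \<in> V. f w = f u}"
    and b: "\<And>u v. u \<in> U \<Longrightarrow> v \<in> V \<Longrightarrow> f v = f u \<Longrightarrow>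
       color_degree c {w \<in> V. f w = f u} i v = b u"
    and inj: "inj_on b U"
  obtains x where "x \<le> 3" "b ` U = {0..3} - {x}" "card A + class_bound x \<le> 19"
proof -
  have "finite U" using assms(2) by (metis card.infinite zero_neq_numeral)
  have bounds: "b u \<le> 3 \<and> card {w \<in> V. f w = f u} \<le> class_bound (b u)" if "u \<in> U" for u
    using regular_paw_free_bounds[OF _ _ mono[OF that], of i "b u"] b[OF that] assms(1,4) that
    by auto
  have sub: "b ` U \<subseteq> {0..3}" using bounds by auto
  have "card (b ` U) = 3" using card_image[OF inj] assms(2) by simp
  then have "card ({0..3} - b ` U) = 1" using sub by (simp add: card_Diff_subset \<open>finite U\<close>)
  then obtain x where "{0..3} - b ` U = {x}" by (rule card_1_singletonE)
  then have x: "x \<le> 3" "b ` U = {0..3} - {x}" using sub by auto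
  have "A = (\<Union>u\<in>U. {w \<in> V. f w = f u})" using A by auto
  then have "card A \<le> (\<Sum>u\<in>U. card {w \<in> V. f w = f u})"
    using card_UN_le[OF \<open>finite U\<close>] by simp
  also have "\<dots> \<le> (\<Sum>u\<in>U. class_bound (b u))" by (rule sum_mono) (use bounds in auto)
  also have "\<dots> = (\<Sum>y\<in>b ` U. class_bound y)" using inj by (simp add: sum.reindex)
  also have "\<dots> = (\<Sum>y\<in>{0..3} - {x}. class_bound y)" by (simp add: x)
  finally have "card A + class_bound x \<le> (\<Sum>y\<in>{0..3}. class_bound y)"
    using sum.remove[of "{0..3}" x class_bound] x(1) by simp
  also have "\<dots> = 19" by (simp add: class_bound_def numeral_3_eq_3)
  finally show thesis using that x by blast
qed

section \<open>At least 31 vertices\<close>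

lemma finite_classes_card_le:
  assumes "finite V" "\<And>y. y \<in> f ` V \<Longrightarrow> card {v \<in> V. f v = y} \<le> k"
  shows "card V \<le> k * card (f ` V)"
proof -
  have "V = (\<Union>y\<in>f ` V. {v \<in> V. f v = y})" by auto
  then have "card V \<le> (\<Sum>y\<in>f ` V. card {v \<in> V. f v = y})"
    using card_UN_le[of "f ` V" "\<lambda>y. {v \<in> V. f v = y}"] assms(1) by simp
  also have "\<dots> \<le> (\<Sum>y\<in>f ` V. k)" by (rule sum_mono) (use assms in auto)
  finally show ?thesis by (simp add: mult.commute)
qed

text \<open>
  The premises express that there is no singular paw: \<open>f\<close> is constant on subsets of a class and
  injective on partial transversals.
\<close>

lemma no_coloring_on_31_vertices:
  fixes c :: "'a set \<Rightarrow> bool" and V :: "'a set"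
  defines "f \<equiv> color_degree c V True"
  assumes "finite V" "31 \<le> card V"
    and mono: "\<And>W y. W \<subseteq> V \<Longrightarrow> f ` W \<subseteq> {y} \<Longrightarrow> paw_free c W"
    and rainbow: "\<And>W. W \<subseteq> V \<Longrightarrow> inj_on f W \<Longrightarrow> paw_free c W"
  shows False
proof -
  have class_mono: "paw_free c {v \<in> V. f v = y}" for y
    by (rule mono[of _ y]) auto
  have "card V \<le> 6 * card (f ` V)"
    by (rule finite_classes_card_le)
      (use assms(2) in \<open>auto intro!: paw_free_card_le_6[where c = c] class_mono\<close>)
  \<comment> \<open>A transversal \<open>W\<close> of the classes, whose two triangles \<open>U\<close> and \<open>W - U\<close> generate the
    sides.\<close>
  obtain W where W: "W \<subseteq> V" "inj_on f W" "f ` W = f ` V"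
    by (metis subset_image_inj order_refl)
  have "finite W" using W(1) assms(2) finite_subset by blast
  have "card W = card (f ` V)" using W card_image by metis
  then have "6 \<le> card W" using \<open>card V \<le> 6 * card (f ` V)\<close> assms(3) by linarith
  obtain i U where "card W = 6" and U: "U \<subseteq> W" "card U = 3" "card (W - U) = 3"
      "mono_on_pairs c i U" "mono_on_pairs c i (W - U)"
    using paw_free_six_vertices[OF \<open>finite W\<close> \<open>6 \<le> card W\<close> rainbow[OF W(1,2)]] by metis
  have six: "card (f ` V) = 6" using \<open>card W = 6\<close> \<open>card W = card (f ` V)\<close> by simp
  note between = color_between_classes[OF assms(2) six rainbow]

  define A where "A = {v \<in> V. f v \<in> f ` U}"
  define B where "B = {v \<in> V. f v \<in> f ` (W - U)}"
  have "f ` U \<inter> f ` (W - U) = {}" using U(1) W(2) by (auto dest: inj_onD)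
  then have AB: "A \<inter> B = {}" by (auto simp: A_def B_def)
  have "f ` U \<union> f ` (W - U) = f ` V"
    using W(3) U(1) by (metis image_Un Un_Diff_cancel sup.absorb2)
  then have "A \<union> B = V" by (auto simp: A_def B_def)
  have "card V = card A + card B"
    using card_Un_disjoint[OF _ _ AB] \<open>A \<union> B = V\<close> assms(2) by (simp add: A_def B_def)

  have cross: "c {v, w} = i \<longleftrightarrow> (v \<in> A \<longleftrightarrow> w \<in> A)"
    if "v \<in> V" "w \<in> V" "f w \<noteq> f v" for v w
  proof -
    have "f v \<in> f ` W" "f w \<in> f ` W" using W(3) that by simp_all
    then obtain v0 w0 where 0: "v0 \<in> W" "w0 \<in> W" "f v0 = f v" "f w0 = f w"
      by (auto elim!: imageE)
    have eq: "c {v, w} = c {v0, w0}"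
      by (rule between) (use 0 W(1) that in auto)
    have mem: "x0 \<in> U \<longleftrightarrow> x \<in> A" if "x0 \<in> W" "f x0 = f x" "x \<in> V" for x x0
      using inj_on_image_mem_iff[OF W(2) that(1) U(1)] that(2,3) by (simp add: A_def)
    have "v0 \<noteq> w0" using 0 that by auto
    have "c {v0, w0} = i \<longleftrightarrow> (v0 \<in> U \<longleftrightarrow> w0 \<in> U)"
    proof (cases "v0 \<in> U \<longleftrightarrow> w0 \<in> U")
      case True
      then show ?thesis
        using mono_on_pairsD[OF U(4)] mono_on_pairsD[OF U(5)] 0 \<open>v0 \<noteq> w0\<close> by auto
    next
      case False
      have "c {x, u} \<noteq> i" if "x \<in> W - U" "u \<in> U" for x u
        using triangle_forces_cross[OF rainbow[OF W(1,2)] U(1,2,4)] that .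
      from this[of v0 w0] this[of w0 v0] False 0 show ?thesis
        by (auto simp: insert_commute)
    qed
    with eq mem[OF 0(1,3) that(1)] mem[OF 0(2,4) that(2)] show ?thesis by simp
  qed

  define D where "D = color_degree c V i"
  define b where "b v = color_degree c {w \<in> V. f w = f v} (\<not> i) v" for v
  have degA: "D v + b v + 1 = card A" if "v \<in> A" for v
    unfolding D_def b_def
    by (rule side_degree[OF assms(2) _ that]) (use that cross in \<open>auto simp: A_def\<close>)
  have notA: "v \<in> A \<longleftrightarrow> v \<notin> B" if "v \<in> V" for v using that AB \<open>A \<union> B = V\<close> by auto
  have degB: "D v + b v + 1 = card B" if "v \<in> B" for v
    unfolding D_def b_def
  proof (rule side_degree[OF assms(2) _ that])
    have "v \<in> V" using that by (simp add: B_def)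
    show "B \<subseteq> V" by (auto simp: B_def)
    show "{w \<in> V. f w = f v} \<subseteq> B" using that by (auto simp: B_def)
    show "c {v, w} = i \<longleftrightarrow> w \<in> B" if "w \<in> V" "f w \<noteq> f v" for w
      using cross[OF \<open>v \<in> V\<close> that] notA[OF that(1)] notA[OF \<open>v \<in> V\<close>] \<open>v \<in> B\<close> by blast
  qed
  \<comment> \<open>The classes are the level sets of the degree in color \<open>True\<close>, but the two degrees of a
    vertex determine each other, so that color \<open>i\<close> yields the same classes.\<close>
  have D_eq: "D v = D w \<longleftrightarrow> f v = f w" if "v \<in> V" "w \<in> V" for v w
    using color_degree_add[OF assms(2) that(1), of c True]
      color_degree_add[OF assms(2) that(2), of c True]
    by (cases i) (auto simp: D_def f_def)
  have side: "\<exists>x. x \<le> 3 \<and> b ` T = {0..3} - {x} \<and> card S + class_bound x \<le> 19"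
    if T: "T \<subseteq> W" "card T = 3" "S = {v \<in> V. f v \<in> f ` T}"
      and degS: "\<And>v. v \<in> S \<Longrightarrow> D v + b v + 1 = card S" for T S
  proof -
    have TS: "t \<in> S" if "t \<in> T" for t using that T W(1) by auto
    have "inj_on f T" using W(2) T(1) inj_on_subset by blast
    have inj: "inj_on b T"
    proof (rule inj_onI)
      fix s t assume "s \<in> T" "t \<in> T" "b s = b t"
      then have "D s = D t" using degS[of s] degS[of t] TS by simp
      then have "f s = f t" using D_eq \<open>s \<in> T\<close> \<open>t \<in> T\<close> T(1) W(1) by blast
      then show "s = t" using \<open>inj_on f T\<close> \<open>s \<in> T\<close> \<open>t \<in> T\<close> by (auto dest: inj_onD)
    qed
    have const: "color_degree c {w \<in> V. f w = f t} (\<not> i) v = b t"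
      if "t \<in> T" "v \<in> V" "f v = f t" for t v
    proof -
      have "t \<in> V" using that T(1) W(1) by blast
      have "v \<in> S" using that T(3) by auto
      moreover have "D v = D t" using D_eq[OF \<open>v \<in> V\<close> \<open>t \<in> V\<close>] that by simp
      ultimately have "b v = b t" using degS[of v] degS[OF TS[OF that(1)]] by simp
      then show ?thesis using that(3) by (simp add: b_def)
    qed
    show ?thesis
      by (rule side_size_bound[OF assms(2) T(2) \<open>inj_on f T\<close> _ T(3) class_mono const inj])
        (use T W in auto)
  qed
  obtain x where x: "x \<le> 3" "b ` U = {0..3} - {x}" "card A + class_bound x \<le> 19"
    using side[OF U(1,2) A_def degA] by blast
  obtain y where y: "y \<le> 3" "b ` (W - U) = {0..3} - {y}" "card B + class_bound y \<le> 19"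
    using side[OF _ U(3) B_def degB] by blast
  have separate: "card A + t \<noteq> card B + s"
    if "s \<le> 3" "s \<noteq> x" "t \<le> 3" "t \<noteq> y" for s t
  proof
    assume eq: "card A + t = card B + s"
    have "s \<in> b ` U" "t \<in> b ` (W - U)" using that x(2) y(2) by auto
    then obtain u v where uv: "u \<in> U" "b u = s" "v \<in> W - U" "b v = t" by auto
    then have "u \<in> A" "v \<in> B" using U(1) W(1) by (auto simp: A_def B_def)
    then have "D u = D v" using degA[of u] degB[of v] uv eq by simp
    then have "f u = f v" using D_eq \<open>u \<in> A\<close> \<open>v \<in> B\<close> by (simp add: A_def B_def)
    with uv U(1) W(2) show False by (auto dest: inj_onD)
  qed
  have sum31: "31 \<le> card A + card B" using \<open>card V = card A + card B\<close> assms(3) by simp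
  \<comment> \<open>Missing values 0 or 1 mean that the inner degrees 2 and 3 occur on both sides. The sizes of
    the sides differ by at most 1, and in each of the three cases two classes from different
    sides get the same degree.\<close>
  have "class_bound x + class_bound y \<le> 7" using x(3) y(3) sum31 by linarith
  then have xy: "x + y \<le> 1" by (auto simp: class_bound_def split: if_splits)
  have "card A \<le> 16 \<and> card B \<le> 16"
    using x(3) y(3) by (auto simp: class_bound_def split: if_splits)
  then have "card A = card B \<or> card A = card B + 1 \<or> card B = card A + 1"
    using sum31 by linarith
  then show False
    using separate[of 3 3] separate[of 3 2] separate[of 2 3] xy by auto
qed

section \<open>A coloring on 30 vertices\<close>

text \<open>
  The classes are the blocks of six consecutive numbers, that is, the level sets of \<open>v div 6\<close>.
  Blocks 0 and 1 form one side together with the vertex 24 of block 4; all other vertices form the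
  other side. In even blocks the red edges are those between the two halves, in odd blocks those
  within the halves. Putting exactly one vertex of block 4 on the first side makes the degrees of
  the five blocks distinct: the cross degree is 7 in blocks 0 and 1, 11 in blocks 2 and 3, and
  12 in block 4, to which the inner degree adds 3 in even and 2 in odd blocks.
\<close>

definition half :: "nat \<Rightarrow> bool" where
  "half v \<longleftrightarrow> v mod 6 < 3"

definition side :: "nat \<Rightarrow> bool" where
  "side v \<longleftrightarrow> v < 12 \<or> v = 24"

definition red :: "nat \<Rightarrow> nat \<Rightarrow> bool" where
  "red u v \<longleftrightarrow> (if u div 6 = v div 6 then (half u = half v) = odd (u div 6) else side u = side v)"

definition coloring30 :: "nat set \<Rightarrow> bool" where
  "coloring30 e \<longleftrightarrow> (\<forall>u\<in>e. \<forall>v\<in>e. u \<noteq> v \<longrightarrow> red u v)"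

definition degree30 :: "nat \<Rightarrow> nat" where
  "degree30 q = [10, 9, 14, 13, 15] ! q"

lemma coloring30_pair: "u \<noteq> v \<Longrightarrow> coloring30 {u, v} \<longleftrightarrow> red u v"
  by (auto simp: coloring30_def red_def)

text \<open>
  The degrees are found by evaluating the definition at each of the 30 vertices.
\<close>

lemma color_degree_coloring30:
  assumes "v < 30"
  shows "color_degree coloring30 {..<30} True v = degree30 (v div 6)"
proof -
  have "\<forall>v\<in>set [0..<30]. length (filter (\<lambda>w. w \<noteq> v \<and> red v w) [0..<30]) = degree30 (v div 6)"
    by code_simp
  then have "length (filter (\<lambda>w. w \<noteq> v \<and> red v w) [0..<30]) = degree30 (v div 6)"
    using assms by auto
  moreover have "{w \<in> {..<30}. w \<noteq> v \<and> coloring30 {v, w} = True} =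
      set (filter (\<lambda>w. w \<noteq> v \<and> red v w) [0..<30])"
    by (auto simp: coloring30_pair)
  ultimately show ?thesis
    by (simp only: color_degree_def distinct_card[OF distinct_filter[OF distinct_upt]])
qed

lemma color_degree_coloring30_eq_iff:
  assumes "u < 30" "v < 30"
  shows "color_degree coloring30 {..<30} i u = color_degree coloring30 {..<30} i v \<longleftrightarrow>
    u div 6 = v div 6"
proof -
  have "u div 6 \<in> {0, 1, 2, 3, 4}" "v div 6 \<in> {0, 1, 2, 3, 4}" using assms by auto
  then have "degree30 (u div 6) = degree30 (v div 6) \<longleftrightarrow> u div 6 = v div 6"
    by (auto simp: degree30_def)
  then show ?thesis
    using color_degree_add[of "{..<30}" u coloring30 True]
      color_degree_add[of "{..<30}" v coloring30 True] assms
    by (cases i) (auto simp: color_degree_coloring30)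
qed

text \<open>
  If the color of an edge only depends on whether its ends lie in the same part of a bipartition
  \<open>s\<close>, then a monochromatic triangle must lie within one part, since two of its vertices always
  share a part. The pendant edge has the same color, hence it stays in that part as well.
\<close>

lemma paw_in_two_part_coloring:
  assumes "paw c i x y z w"
    and "\<And>u v. u \<in> {x, y, z, w} \<Longrightarrow> v \<in> {x, y, z, w} \<Longrightarrow> u \<noteq> v \<Longrightarrow> c {u, v} = (s u = s v) \<longleftrightarrow> k"
  shows "s x = s y \<and> s y = s z \<and> s z = (s w :: bool)"
proof -
  have color: "i = (s u = s v) \<longleftrightarrow> k"
    if "c {u, v} = i" "u \<in> {x, y, z, w}" "v \<in> {x, y, z, w}" "u \<noteq> v" for u v
    using assms(2)[OF that(2-4)] that(1) by simp
  have "i = (s x = s y) \<longleftrightarrow> k" "i = (s x = s z) \<longleftrightarrow> k" "i = (s y = s z) \<longleftrightarrow> k" "i = (s z = s w) \<longleftrightarrow> k"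
    by (rule color; use assms(1) in \<open>simp add: paw_def\<close>)+
  then show ?thesis by (cases k; cases "s x"; cases "s y"; cases "s z"; cases "s w"; simp)
qed

text \<open>
  Such a paw would lie in one half of its block, which only has three vertices.
\<close>

lemma no_paw_in_class:
  assumes paw: "paw coloring30 i x y z w"
  shows "\<not> (x div 6 = q \<and> y div 6 = q \<and> z div 6 = q \<and> w div 6 = q)"
proof
  assume q: "x div 6 = q \<and> y div 6 = q \<and> z div 6 = q \<and> w div 6 = q"
  have "half x = half y \<and> half y = half z \<and> half z = half w"
  proof (rule paw_in_two_part_coloring[OF paw])
    fix u v assume "u \<in> {x, y, z, w}" "v \<in> {x, y, z, w}" "u \<noteq> v"
    then have "u div 6 = q" "v div 6 = q" "u \<noteq> v" using q by blast+
    then show "coloring30 {u, v} = (half u = half v) \<longleftrightarrow> odd q"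
      by (simp add: coloring30_pair red_def) blast
  qed
  then have halves: "half x = half w" "half y = half w" "half z = half w" by blast+
  have interval: "v \<in> (if half v then {6 * q..<6 * q + 3} else {6 * q + 3..<6 * q + 6})"
    if "v div 6 = q" for v
    using mult_div_mod_eq[of 6 v] that by (auto simp: half_def)
  have "{x, y, z, w} \<subseteq> (if half w then {6 * q..<6 * q + 3} else {6 * q + 3..<6 * q + 6})"
    (is "_ \<subseteq> ?S")
    using q interval[of x] interval[of y] interval[of z] interval[of w] unfolding halves by simp
  then have "card {x, y, z, w} \<le> card ?S" by (intro card_mono) auto
  moreover have "card ?S = 3" by simp
  ultimately have "card {x, y, z, w} \<le> 3" by (simp only:)
  then show False using paw by (simp add: paw_def)
qed

text \<open>
  Such a paw would lie on one side, but each side only meets three blocks: one side meets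
  0, 1 and 4, the other 2, 3 and 4.
\<close>

lemma no_paw_across_classes:
  assumes paw: "paw coloring30 i x y z w"
    and "x < 30" "y < 30" "z < 30" "w < 30"
  shows "\<not> distinct [x div 6, y div 6, z div 6, w div 6]"
proof
  assume d: "distinct [x div 6, y div 6, z div 6, w div 6]"
  have same: "side x = side y \<and> side y = side z \<and> side z = side w"
  proof (rule paw_in_two_part_coloring[OF paw])
    fix u v assume "u \<in> {x, y, z, w}" "v \<in> {x, y, z, w}" "u \<noteq> v"
    then have "u div 6 \<noteq> v div 6" "u \<noteq> v" using d by auto
    then show "coloring30 {u, v} = (side u = side v) \<longleftrightarrow> True"
      by (simp add: coloring30_pair red_def)
  qed
  have "v div 6 \<in> (if side v then {0, 1, 4} else {2, 3, 4})" if "v < 30" for v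
    using that by (auto simp: side_def)
  from this[OF assms(2)] this[OF assms(3)] this[OF assms(4)] this[OF assms(5)]
  show False using d same by (cases "side w") auto
qed

section \<open>The singular Ramsey number of the paw\<close>

lemma degree_color_graph:
  assumes "v < m"
  shows "degree (color_graph m c i) v = color_degree c {..<m} i v"
proof -
  have "{e \<in> edges (color_graph m c i). v \<in> e} =
      (\<lambda>w. {v, w}) ` {w \<in> {..<m}. w \<noteq> v \<and> c {v, w} = i}"
    using assms by (auto simp: color_graph_def elim!: nsets2_E) (auto simp: insert_commute)
  moreover have "inj_on (\<lambda>w. {v, w}) {w \<in> {..<m}. w \<noteq> v \<and> c {v, w} = i}"
    by (auto simp: inj_on_def doubleton_eq_iff)
  ultimately show ?thesis by (simp add: degree_def color_degree_def card_image)
qed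

definition singular_paw ::
    "('a set \<Rightarrow> bool) \<Rightarrow> 'a set \<Rightarrow> bool \<Rightarrow> 'a \<Rightarrow> 'a \<Rightarrow> 'a \<Rightarrow> 'a \<Rightarrow> bool" where
  "singular_paw c V i x y z w \<longleftrightarrow> {x, y, z, w} \<subseteq> V \<and> paw c i x y z w \<and>
     ((\<exists>d. color_degree c V i ` {x, y, z, w} \<subseteq> {d}) \<or>
      inj_on (color_degree c V i) {x, y, z, w})"

text \<open>
  The isomorphism sends the vertices 0, 1, 2, 3 of \<^const>\<open>PW\<close> to \<open>x, y, z, w\<close>; vertex 2 is the
  one at which the pendant edge is attached.
\<close>

lemma singular_paw_iff:
  "(\<exists>H. singular_subgraph H (color_graph m c i) \<and> graph_iso PW H) \<longleftrightarrow>
   (\<exists>x y z w. singular_paw c {..<m} i x y z w)"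
  (is "?L \<longleftrightarrow> ?R")
proof
  assume ?L
  then obtain H \<phi> where H: "singular_subgraph H (color_graph m c i)"
    and bij: "bij_betw \<phi> (verts PW) (verts H)"
    and iso: "\<And>u v. u \<in> verts PW \<Longrightarrow> v \<in> verts PW \<Longrightarrow>
      {u, v} \<in> edges PW \<longleftrightarrow> {\<phi> u, \<phi> v} \<in> edges H"
    unfolding graph_iso_def by blast
  have V: "verts H = {\<phi> 0, \<phi> 1, \<phi> 2, \<phi> 3}"
    using bij by (auto simp: bij_betw_def PW_def)
  have sub: "verts H \<subseteq> {..<m}" "edges H \<subseteq> {e. c e = i}"
    using H by (auto simp: singular_subgraph_def subgraph_def color_graph_def)
  have "distinct [\<phi> 0, \<phi> 1, \<phi> 2, \<phi> 3]"
    using bij by (auto simp: bij_betw_def PW_def)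
  moreover have "{\<phi> 0, \<phi> 1} \<in> edges H" "{\<phi> 0, \<phi> 2} \<in> edges H" "{\<phi> 1, \<phi> 2} \<in> edges H"
    "{\<phi> 2, \<phi> 3} \<in> edges H"
    using iso[of 0 1] iso[of 0 2] iso[of 1 2] iso[of 2 3] by (auto simp: PW_def)
  ultimately have paw: "paw c i (\<phi> 0) (\<phi> 1) (\<phi> 2) (\<phi> 3)"
    using sub(2) by (auto simp: paw_def)
  have deg: "degree (color_graph m c i) v = color_degree c {..<m} i v"
    if "v \<in> verts H" for v
    using that sub(1) by (auto intro: degree_color_graph)
  have "(\<exists>d. color_degree c {..<m} i ` verts H \<subseteq> {d}) \<or>
      inj_on (color_degree c {..<m} i) (verts H)"
  proof (cases "\<forall>u\<in>verts H. \<forall>v\<in>verts H. degree (color_graph m c i) u = degree (color_graph m c i) v")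
    case True
    have "\<phi> 0 \<in> verts H" by (simp add: V)
    then have "color_degree c {..<m} i ` verts H \<subseteq> {color_degree c {..<m} i (\<phi> 0)}"
      using True deg by (metis image_subsetI singletonI)
    then show ?thesis by blast
  next
    case False
    then have "inj_on (color_degree c {..<m} i) (verts H)"
      using H deg unfolding singular_subgraph_def inj_on_def by metis
    then show ?thesis by blast
  qed
  then have "singular_paw c {..<m} i (\<phi> 0) (\<phi> 1) (\<phi> 2) (\<phi> 3)"
    using paw sub(1) unfolding V singular_paw_def by (intro conjI)
  then show ?R by blast
next
  assume ?R
  then obtain x y z w where "singular_paw c {..<m} i x y z w" by blast
  then have V: "{x, y, z, w} \<subseteq> {..<m}" and paw: "paw c i x y z w"
    and sing: "(\<exists>d. color_degree c {..<m} i ` {x, y, z, w} \<subseteq> {d}) \<or>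
      inj_on (color_degree c {..<m} i) {x, y, z, w}"
    by (simp_all only: singular_paw_def)
  define H where "H = ({x, y, z, w}, {{x, y}, {x, z}, {y, z}, {z, w}})"
  have sub: "subgraph H (color_graph m c i)"
    using V paw by (auto simp: subgraph_def simple_graph_def color_graph_def H_def paw_def)
  have deg: "degree (color_graph m c i) v = color_degree c {..<m} i v"
    if "v \<in> verts H" for v
    using that V by (auto intro: degree_color_graph simp: H_def)
  have "(\<forall>u\<in>verts H. \<forall>v\<in>verts H. degree (color_graph m c i) u = degree (color_graph m c i) v) \<or>
      (\<forall>u\<in>verts H. \<forall>v\<in>verts H. u \<noteq> v \<longrightarrow>
        degree (color_graph m c i) u \<noteq> degree (color_graph m c i) v)"
    using sing
  proof
    assume "\<exists>d. color_degree c {..<m} i ` {x, y, z, w} \<subseteq> {d}"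
    then obtain d where "color_degree c {..<m} i v = d" if "v \<in> verts H" for v
      by (auto simp: H_def)
    with deg show ?thesis by simp
  next
    assume "inj_on (color_degree c {..<m} i) {x, y, z, w}"
    then have "inj_on (color_degree c {..<m} i) (verts H)" by (simp only: H_def fst_conv)
    with deg show ?thesis by (metis inj_onD)
  qed
  with sub have "singular_subgraph H (color_graph m c i)"
    by (simp only: singular_subgraph_def)
  moreover have "graph_iso PW H"
    unfolding graph_iso_def
  proof (intro exI conjI)
    let ?\<phi> = "\<lambda>n::nat. if n = 0 then x else if n = 1 then y else if n = 2 then z else w"
    show "bij_betw ?\<phi> (verts PW) (verts H)"
      using paw by (auto simp: bij_betw_def inj_on_def PW_def H_def paw_def)
    show "\<forall>u\<in>verts PW. \<forall>v\<in>verts PW. {u, v} \<in> edges PW \<longleftrightarrow> {?\<phi> u, ?\<phi> v} \<in> edges H"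
      using paw by (auto simp: PW_def H_def paw_def doubleton_eq_iff)
  qed
  ultimately show ?L by blast
qed

lemma singular_Ramsey_bound_PW_31: "singular_Ramsey_bound PW 31"
  unfolding singular_Ramsey_bound_def singular_paw_iff
proof (intro allI impI, rule ccontr)
  fix m :: nat and c
  let ?f = "color_degree c {..<m}"
  assume "31 \<le> m" and none: "\<not> (\<exists>i x y z w. singular_paw c {..<m} i x y z w)"
  have f_eq: "?f i u = ?f i v \<longleftrightarrow> ?f True u = ?f True v" if "u < m" "v < m" for i u v
    using color_degree_add[of "{..<m}" u c True] color_degree_add[of "{..<m}" v c True] that
    by (cases i) auto
  show False
  proof (rule no_coloring_on_31_vertices[of "{..<m}" c])
    show "paw_free c W" if W: "W \<subseteq> {..<m}" "?f True ` W \<subseteq> {y}" for W y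
      unfolding paw_free_def
    proof (intro allI ballI notI)
      fix i p q r s assume *: "p \<in> W" "q \<in> W" "r \<in> W" "s \<in> W" "paw c i p q r s"
      have eq: "?f i v = ?f i p" if "v \<in> W" for v
        using f_eq[of v p i] that * W by auto
      have "?f i ` {p, q, r, s} \<subseteq> {?f i p}"
        using eq[OF *(2)] eq[OF *(3)] eq[OF *(4)] by simp
      moreover have "{p, q, r, s} \<subseteq> {..<m}" using * W(1) by auto
      ultimately have "singular_paw c {..<m} i p q r s"
        using *(5) unfolding singular_paw_def by (intro conjI disjI1 exI)
      then show False using none by blast
    qed
    show "paw_free c W" if W: "W \<subseteq> {..<m}" "inj_on (?f True) W" for W
      unfolding paw_free_def
    proof (intro allI ballI notI)
      fix i p q r s assume *: "p \<in> W" "q \<in> W" "r \<in> W" "s \<in> W" "paw c i p q r s"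
      have "inj_on (?f i) W"
        using W f_eq[of _ _ i] unfolding inj_on_def by (metis lessThan_iff subsetD)
      then have "inj_on (?f i) {p, q, r, s}" by (rule inj_on_subset) (use * in auto)
      moreover have "{p, q, r, s} \<subseteq> {..<m}" using * W(1) by auto
      ultimately have "singular_paw c {..<m} i p q r s"
        using *(5) unfolding singular_paw_def by (intro conjI disjI2)
      then show False using none by blast
    qed
  qed (use \<open>31 \<le> m\<close> in auto)
qed

lemma singular_Ramsey_bound_PW_ge_31:
  assumes "singular_Ramsey_bound PW N"
  shows "31 \<le> N"
proof (rule ccontr)
  assume "\<not> 31 \<le> N"
  then have "N \<le> 30" by simp
  let ?f = "color_degree coloring30 {..<30}"
  obtain i x y z w where "singular_paw coloring30 {..<30} i x y z w"
    using assms \<open>N \<le> 30\<close> unfolding singular_Ramsey_bound_def singular_paw_iff by blast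
  then have V: "{x, y, z, w} \<subseteq> {..<30}" and paw: "paw coloring30 i x y z w"
    and sing: "(\<exists>d. ?f i ` {x, y, z, w} \<subseteq> {d}) \<or> inj_on (?f i) {x, y, z, w}"
    by (simp_all only: singular_paw_def)
  have lt: "x < 30" "y < 30" "z < 30" "w < 30" using V by auto
  note eq_iff = color_degree_coloring30_eq_iff[where i = i]
  from sing show False
  proof
    assume "\<exists>d. ?f i ` {x, y, z, w} \<subseteq> {d}"
    then have "?f i x = ?f i w" "?f i y = ?f i w" "?f i z = ?f i w" by auto
    then show False using no_paw_in_class[OF paw] eq_iff lt by blast
  next
    assume "inj_on (?f i) {x, y, z, w}"
    moreover have "distinct [x, y, z, w]" using paw by (simp add: paw_def)
    ultimately have "distinct (map (?f i) [x, y, z, w])"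
      by (simp only: distinct_map) simp
    then show False using no_paw_across_classes[OF paw lt] eq_iff lt by simp
  qed
qed

theorem theorem30:
  shows "(\<exists>N. singular_Ramsey_bound PW N) \<and> Rs PW = 31"
proof -
  have "Rs PW = 31"
    unfolding Rs_def
    using singular_Ramsey_bound_PW_31 singular_Ramsey_bound_PW_ge_31 by (rule Least_equality)
  then show ?thesis using singular_Ramsey_bound_PW_31 by blast
qed

end
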